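(* Let $n,r,s\ge 1$ and $m\ge 0$ be integers, and let $u_n=Z(\mathrm{U}_{n,m}^{(r,s)})$ be the Hosoya index of the graph $\mathrm{U}_{n,m}^{(r,s)}$ described in the context; by convention $u_0=2$. Put $M=(m+1)^2+r+s$. Then for every $n\ge 1$, $$ \frac{u_n}{u_{n-1}}=x_n , $$ where $x_1,x_2,\dots$ are defined by $x_1=M-\frac{M}{2}$ and $x_{k+1}=M-\frac{rs}{x_k}$ for $k\ge 1$. In continued-fraction notation, $$ \frac{u_n}{u_{n-1}}=M-\cfrac{rs}{M-\cfrac{rs}{\ddots-\cfrac{rs}{M-\cfrac{M}{2}}}}, $$ with $M$ appearing $n$ times. Furthermore, for $n\ge 1$, $$ u_n=\left(\frac{M+\sqrt{M^2-4rs}}{2}\right)^n+\left(\frac{M-\sqrt{M^2-4rs}}{2}\right)^n . $$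
   Context: Graphs may have parallel edges. The Hosoya index $Z(G)$ of a finite multigraph $G$ is the number of matchings of $G$, that is, the number of sets of pairwise vertex-disjoint edges, including the empty set. Parallel edges are counted as distinct edges. The graph $\mathrm{U}_{n,m}^{(r,s)}$ is built as follows. Take a cycle on $2n$ vertices $v_1,\dots,v_{2n}$ (indices taken mod $2n$). For each $i$, join $v_{2i-1}$ and $v_{2i}$ by $r$ parallel edges, and join $v_{2i}$ and $v_{2i+1}$ by $s$ parallel edges. When $n=1$, this means $v_1$ and $v_2$ are joined by $r+s$ parallel edges. Finally, attach $m$ pendant vertices (leaves) to each $v_j$. For example, benzene $\mathrm{C}_6\mathrm{H}_6$ corresponds to $\mathrm{U}_{3,1}^{(2,1)}$. *)

theory Defs
  imports Complex_Main
begin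

record ('v, 'e) multigraph =
  verts :: "'v set"
  edges :: "'e set"
  ends :: "'e \<Rightarrow> 'v set"

locale finite_multigraph =
  fixes G :: "('v, 'e, 'x) multigraph_scheme"
  assumes finite_verts: "finite (verts G)"
    and finite_edges: "finite (edges G)"
    and ends_subset: "e \<in> edges G \<Longrightarrow> ends G e \<subseteq> verts G"
    and card_ends: "e \<in> edges G \<Longrightarrow> card (ends G e) = 2"

text \<open>A matching is a set of edges, not of vertex pairs, so that parallel edges are
  told apart.\<close>

definition is_matching :: "('v, 'e, 'x) multigraph_scheme \<Rightarrow> 'e set \<Rightarrow> bool" where
  "is_matching G F \<longleftrightarrow> F \<subseteq> edges G \<and> pairwise (\<lambda>e f. disjnt (ends G e) (ends G f)) F"

definition hosoya_index :: "('v, 'e, 'x) multigraph_scheme \<Rightarrow> nat" where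
  "hosoya_index G = card {F. is_matching G F}"

datatype U_vertex = Cyc nat | Leaf nat nat

datatype U_edge = R_edge nat nat | S_edge nat nat | Leaf_edge nat nat

text \<open>The cycle vertex \<open>v\<^sub>j\<close> is \<open>Cyc (j mod (2 * n))\<close>; in particular \<open>v\<^bsub>2n\<^esub>\<close> is
  \<open>Cyc 0\<close> and \<open>v\<^bsub>2n+1\<^esub> = v\<^sub>1\<close>. The last argument of each edge constructor, and of
  \<open>Leaf\<close>, numbers the parallel edges and the leaves at a vertex.\<close>

fun U_ends :: "nat \<Rightarrow> U_edge \<Rightarrow> U_vertex set" where
  "U_ends n (R_edge i k) = {Cyc ((2 * i - 1) mod (2 * n)), Cyc ((2 * i) mod (2 * n))}"
| "U_ends n (S_edge i k) = {Cyc ((2 * i) mod (2 * n)), Cyc ((2 * i + 1) mod (2 * n))}"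
| "U_ends n (Leaf_edge j l) = {Cyc (j mod (2 * n)), Leaf (j mod (2 * n)) l}"

definition U_graph :: "nat \<Rightarrow> nat \<Rightarrow> nat \<Rightarrow> nat \<Rightarrow> (U_vertex, U_edge) multigraph" where
  "U_graph n m r s =
    \<lparr>verts = {Cyc j | j. j < 2 * n} \<union> {Leaf j l | j l. j < 2 * n \<and> l < m},
     edges = {R_edge i k | i k. i \<in> {1..n} \<and> k < r}
           \<union> {S_edge i k | i k. i \<in> {1..n} \<and> k < s}
           \<union> {Leaf_edge j l | j l. j \<in> {1..2 * n} \<and> l < m},
     ends = U_ends n\<rparr>"

lemma Suc_mod_neq: "2 \<le> N \<Longrightarrow> Suc a mod N \<noteq> a mod N"
  by (simp add: mod_Suc)

lemma finite_multigraph_U_graph: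
  assumes "n \<ge> 1"
  shows "finite_multigraph (U_graph n m r s)"
proof
  have "{Cyc j | j. j < 2 * n} = Cyc ` {..<2 * n}"
    "{Leaf j l | j l. j < 2 * n \<and> l < m} = case_prod Leaf ` ({..<2 * n} \<times> {..<m})"
    by auto
  then show "finite (verts (U_graph n m r s))"
    by (simp add: U_graph_def)
  have "{R_edge i k | i k. i \<in> {1..n} \<and> k < r} = case_prod R_edge ` ({1..n} \<times> {..<r})"
    "{S_edge i k | i k. i \<in> {1..n} \<and> k < s} = case_prod S_edge ` ({1..n} \<times> {..<s})"
    "{Leaf_edge j l | j l. j \<in> {1..2 * n} \<and> l < m}
       = case_prod Leaf_edge ` ({1..2 * n} \<times> {..<m})"
    by auto
  then show "finite (edges (U_graph n m r s))"
    unfolding U_graph_def by (simp del: atLeastAtMost_iff)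
next
  fix e assume e: "e \<in> edges (U_graph n m r s)"
  have lt: "a mod (2 * n) < 2 * n" for a
    using assms by simp
  show "ends (U_graph n m r s) e \<subseteq> verts (U_graph n m r s)"
    using e assms by (auto simp: U_graph_def) (use lt in blast)
  have neq: "a mod (2 * n) \<noteq> Suc a mod (2 * n)" for a
    using assms by (intro Suc_mod_neq[symmetric]) simp
  show "card (ends (U_graph n m r s) e) = 2"
  proof (cases e)
    case (R_edge i k)
    then have "2 * i = Suc (2 * i - 1)" using e by (auto simp: U_graph_def)
    then have "(2 * i - 1) mod (2 * n) \<noteq> (2 * i) mod (2 * n)" using neq by metis
    then show ?thesis using R_edge by (simp add: U_graph_def)
  next
    case (S_edge i k)
    then show ?thesis using neq[of "2 * i"] by (simp add: U_graph_def)
  next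
    case (Leaf_edge j l)
    then show ?thesis by (simp add: U_graph_def)
  qed
qed

end

theory Submission imports Defs begin

text \<open>Every matching uses at most one of the \<open>s\<close> parallel edges joining \<open>v\<^bsub>2n\<^esub>\<close> and \<open>v\<^sub>1\<close>.
  Splitting on which one leaves matchings of caterpillars: the path \<open>v\<^sub>1,\<dots>,v\<^bsub>2n\<^esub>\<close>, or the path
  \<open>v\<^sub>2,\<dots>,v\<^bsub>2n-1\<^esub>\<close> if such an edge is used. Stripping the last vertex of a path gives two-term
  recurrences, and eliminating the paths with an odd number of vertices yields
  \<open>u\<^bsub>n+2\<^esub> = M u\<^bsub>n+1\<^esub> - r s u\<^sub>n\<close>, which is equivalent to both the continued fraction and the closed
  formula.\<close>

section \<open>Counting matchings of an edge set\<close>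

text \<open>The incidence map and the edge set are separate arguments, so that edges can be deleted
  without forming new graphs.\<close>

definition num_matchings :: "('e \<Rightarrow> 'v set) \<Rightarrow> 'e set \<Rightarrow> nat" where
  "num_matchings f E = card {F. F \<subseteq> E \<and> pairwise (\<lambda>e g. disjnt (f e) (f g)) F}"

lemma hosoya_index_eq_num_matchings: "hosoya_index G = num_matchings (ends G) (edges G)"
  by (simp add: hosoya_index_def num_matchings_def is_matching_def)

lemma num_matchings_empty [simp]: "num_matchings f {} = 1"
proof -
  have "{F. F \<subseteq> {} \<and> pairwise (\<lambda>e g. disjnt (f e) (f g)) F} = {{}}"
    by auto
  then show ?thesis
    by (simp add: num_matchings_def)
qed

lemma num_matchings_pos:
  assumes "finite E"
  shows "num_matchings f E > 0"
proof -
  have "{} \<in> {F. F \<subseteq> E \<and> pairwise (\<lambda>e g. disjnt (f e) (f g)) F}"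
    by simp
  moreover have "finite {F. F \<subseteq> E \<and> pairwise (\<lambda>e g. disjnt (f e) (f g)) F}"
    using assms by simp
  ultimately show ?thesis
    unfolding num_matchings_def card_gt_0_iff by blast
qed

text \<open>Only which pairs of edges meet matters for the count. This allows one incidence map to
  be exchanged for another.\<close>

lemma num_matchings_cong:
  assumes "\<And>e g. e \<in> E \<Longrightarrow> g \<in> E \<Longrightarrow> disjnt (f e) (f g) \<longleftrightarrow> disjnt (f' e) (f' g)"
  shows "num_matchings f E = num_matchings f' E"
proof -
  have "pairwise (\<lambda>e g. disjnt (f e) (f g)) F \<longleftrightarrow> pairwise (\<lambda>e g. disjnt (f' e) (f' g)) F"
    if "F \<subseteq> E" for F
    using that assms unfolding pairwise_def by (meson subsetD)
  then show ?thesis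
    unfolding num_matchings_def by (metis (lifting))
qed

text \<open>Edges of \<open>S\<close> pairwise meet, so a matching contains at most one of them. If
  it contains \<open>e\<close>, its other edges are exactly a matching among the edges disjoint from
  \<open>e\<close>. The case \<open>e = g\<close> of the last hypothesis says that
  \<open>f e\<close> is nonempty, so \<open>e\<close> itself is not among those edges.\<close>

lemma num_matchings_split:
  assumes fin: "finite E" and SE: "S \<subseteq> E"
    and S: "\<And>e g. e \<in> S \<Longrightarrow> g \<in> S \<Longrightarrow> \<not> disjnt (f e) (f g)"
  shows "num_matchings f E
    = num_matchings f (E - S) + (\<Sum>e\<in>S. num_matchings f {g \<in> E. disjnt (f e) (f g)})"
proof -
  define \<M> where "\<M> A = {F. F \<subseteq> A \<and> pairwise (\<lambda>e g. disjnt (f e) (f g)) F}" for A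
  define \<N> where "\<N> e = insert e ` \<M> {g \<in> E. disjnt (f e) (f g)}" for e
  have fin\<M>: "finite (\<M> A)" if "A \<subseteq> E" for A
    using finite_subset[OF that fin] by (simp add: \<M>_def)
  have finS: "finite S"
    using SE fin finite_subset by blast
  have fin\<N>: "finite (\<N> e)" for e
    unfolding \<N>_def by (intro finite_imageI fin\<M>) auto
  \<comment> \<open>Every other edge of \<open>F\<close> is disjoint from \<open>e\<close>, hence
    outside \<open>S\<close>. So \<open>F\<close> determines \<open>e\<close>, which makes all the
    families of the decomposition disjoint.\<close>
  have inter: "F \<inter> S = {e}" if "e \<in> S" "F \<in> \<N> e" for e F
    using that S unfolding \<N>_def \<M>_def by blast
  have "\<M> E = \<M> (E - S) \<union> (\<Union>e\<in>S. \<N> e)"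
  proof (intro equalityI subsetI)
    fix F assume F: "F \<in> \<M> E"
    show "F \<in> \<M> (E - S) \<union> (\<Union>e\<in>S. \<N> e)"
    proof (cases "F \<inter> S = {}")
      case True
      then show ?thesis using F by (auto simp: \<M>_def)
    next
      case False
      then obtain e where e: "e \<in> F" "e \<in> S" by blast
      have "F - {e} \<in> \<M> {g \<in> E. disjnt (f e) (f g)}"
        using F e by (auto simp: \<M>_def pairwise_def)
      moreover have "F = insert e (F - {e})"
        using e by blast
      ultimately show ?thesis
        using e unfolding \<N>_def by blast
    qed
  next
    fix F assume "F \<in> \<M> (E - S) \<union> (\<Union>e\<in>S. \<N> e)"
    then show "F \<in> \<M> E"
      using SE by (auto simp: \<M>_def \<N>_def pairwise_insert subset_iff disjnt_commute)
  qed
  moreover have "\<M> (E - S) \<inter> (\<Union>e\<in>S. \<N> e) = {}"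
  proof -
    have "F \<inter> S = {}" if "F \<in> \<M> (E - S)" for F
      using that by (auto simp: \<M>_def)
    then show ?thesis
      using inter by blast
  qed
  moreover have "card (\<Union>e\<in>S. \<N> e) = (\<Sum>e\<in>S. card (\<N> e))"
  proof (rule card_UN_disjoint[OF finS])
    show "\<forall>e\<in>S. finite (\<N> e)"
      using fin\<N> by blast
    show "\<forall>e\<in>S. \<forall>g\<in>S. e \<noteq> g \<longrightarrow> \<N> e \<inter> \<N> g = {}"
      using inter by blast
  qed
  moreover have "card (\<N> e) = card (\<M> {g \<in> E. disjnt (f e) (f g)})" if "e \<in> S" for e
  proof -
    have "e \<notin> F" if "F \<in> \<M> {g \<in> E. disjnt (f e) (f g)}" for F
      using that S[OF \<open>e \<in> S\<close> \<open>e \<in> S\<close>] by (auto simp: \<M>_def)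
    then have "inj_on (insert e) (\<M> {g \<in> E. disjnt (f e) (f g)})"
      by (intro inj_onI) (metis insert_ident)
    then show ?thesis
      unfolding \<N>_def by (rule card_image)
  qed
  moreover have "finite (\<M> (E - S))" "finite (\<Union>e\<in>S. \<N> e)"
    using fin\<M> finS fin\<N> by auto
  ultimately show ?thesis
    unfolding num_matchings_def \<M>_def[symmetric] by (simp add: card_Un_disjoint)
qed

section \<open>Matchings of caterpillars\<close>

text \<open>The incidence map of the infinite path covering the cycle: as in \<^const>\<open>U_ends\<close>,
  but without reduction modulo \<open>2 * n\<close>.\<close>

fun path_ends :: "U_edge \<Rightarrow> U_vertex set" where
  "path_ends (R_edge k l) = {Cyc (2 * k - 1), Cyc (2 * k)}"
| "path_ends (S_edge k l) = {Cyc (2 * k), Cyc (2 * k + 1)}"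
| "path_ends (Leaf_edge t l) = {Cyc t, Leaf t l}"

text \<open>The caterpillar on the consecutive vertices \<open>i\<close> to \<open>j\<close>. The
  bound \<open>i < 2 * k\<close> says that the lower end \<open>2 * k - 1\<close> of an
  \<open>R_edge\<close> is at least \<open>i\<close>; it also excludes \<open>k = 0\<close>, where
  truncated subtraction would produce a loop.\<close>

definition path_edges :: "nat \<Rightarrow> nat \<Rightarrow> nat \<Rightarrow> nat \<Rightarrow> nat \<Rightarrow> U_edge set" where
  "path_edges m r s i j =
    {R_edge k l | k l. i < 2 * k \<and> 2 * k \<le> j \<and> l < r}
    \<union> {S_edge k l | k l. i \<le> 2 * k \<and> 2 * k < j \<and> l < s}
    \<union> {Leaf_edge t l | t l. i \<le> t \<and> t \<le> j \<and> l < m}"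

definition path_matchings :: "nat \<Rightarrow> nat \<Rightarrow> nat \<Rightarrow> nat \<Rightarrow> nat \<Rightarrow> nat" where
  "path_matchings m r s i j = num_matchings path_ends (path_edges m r s i j)"

lemma finite_path_edges: "finite (path_edges m r s i j)"
proof (rule finite_subset)
  show "path_edges m r s i j \<subseteq> case_prod R_edge ` ({..j} \<times> {..<r})
      \<union> case_prod S_edge ` ({..j} \<times> {..<s}) \<union> case_prod Leaf_edge ` ({..j} \<times> {..<m})"
    by (auto simp: path_edges_def image_iff)
qed simp

lemma path_matchings_empty: "j < i \<Longrightarrow> path_matchings m r s i j = 1"
proof -
  assume "j < i"
  then have "path_edges m r s i j = {}"
    by (auto simp: path_edges_def)
  then show ?thesis
    by (simp add: path_matchings_def)
qed

text \<open>All edges contain \<open>Cyc i\<close>, so the whole edge set can serve as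
  \<open>S\<close> in \<open>num_matchings_split\<close>: a matching is empty or a single leaf
  edge.\<close>

lemma path_matchings_singleton: "path_matchings m r s i i = m + 1"
proof -
  let ?E = "path_edges m r s i i"
  have E: "?E = Leaf_edge i ` {..<m}"
    by (auto simp: path_edges_def)
  have "path_matchings m r s i i = num_matchings path_ends (?E - ?E)
      + (\<Sum>e\<in>?E. num_matchings path_ends {g \<in> ?E. disjnt (path_ends e) (path_ends g)})"
    unfolding path_matchings_def
    by (rule num_matchings_split) (auto simp: E)
  also have "\<dots> = 1 + (\<Sum>e\<in>?E. 1)"
  proof -
    have empty: "{g \<in> ?E. disjnt (path_ends e) (path_ends g)} = {}" if "e \<in> ?E" for e
      using that by (auto simp: E)
    have "(\<Sum>e\<in>?E. num_matchings path_ends {g \<in> ?E. disjnt (path_ends e) (path_ends g)})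
        = (\<Sum>e\<in>?E. 1)"
      by (rule sum.cong) (simp_all only: empty num_matchings_empty)
    then show ?thesis
      by simp
  qed
  also have "\<dots> = m + 1"
    by (simp add: E card_image inj_on_def)
  finally show ?thesis .
qed

text \<open>The edges at the last vertex \<open>2 * k\<close> pairwise meet there, so
  \<open>num_matchings_split\<close> applies to them. Using none of them, or one of the
  \<open>m\<close> leaf edges, leaves the path up to \<open>2 * k - 1\<close>; using one of the
  \<open>r\<close> parallel edges removes the vertex \<open>2 * k - 1\<close> as well. If
  \<open>i = 2 * k - 1\<close>, the shorter path is empty and counts 1.\<close>

lemma path_matchings_even:
  assumes "1 \<le> i" "i < 2 * k"
  shows "path_matchings m r s i (2 * k)
    = (m + 1) * path_matchings m r s i (2 * k - 1) + r * path_matchings m r s i (2 * k - 2)"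
proof -
  let ?E = "path_edges m r s i (2 * k)"
  let ?L = "Leaf_edge (2 * k) ` {..<m}" and ?R = "R_edge k ` {..<r}"
  let ?Z = "\<lambda>e. num_matchings path_ends {g \<in> ?E. disjnt (path_ends e) (path_ends g)}"
  have "path_matchings m r s i (2 * k)
      = num_matchings path_ends (?E - (?L \<union> ?R)) + sum ?Z (?L \<union> ?R)"
    unfolding path_matchings_def
    by (rule num_matchings_split) (rule finite_path_edges, use assms in \<open>auto simp: path_edges_def\<close>)
  also have "?E - (?L \<union> ?R) = path_edges m r s i (2 * k - 1)"
    using assms by (auto simp: path_edges_def)
  also have "sum ?Z (?L \<union> ?R) = sum ?Z ?L + sum ?Z ?R"
    by (rule sum.union_disjoint) auto
  also have "sum ?Z ?L = (\<Sum>e\<in>?L. path_matchings m r s i (2 * k - 1))"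
  proof (rule sum.cong[OF refl])
    fix e assume "e \<in> ?L"
    then have "{g \<in> ?E. disjnt (path_ends e) (path_ends g)} = path_edges m r s i (2 * k - 1)"
      using assms by (auto simp: path_edges_def)
    then show "?Z e = path_matchings m r s i (2 * k - 1)"
      by (simp add: path_matchings_def)
  qed
  also have "\<dots> = m * path_matchings m r s i (2 * k - 1)"
    by (simp add: card_image inj_on_def)
  also have "sum ?Z ?R = (\<Sum>e\<in>?R. path_matchings m r s i (2 * k - 2))"
  proof (rule sum.cong[OF refl])
    fix e assume "e \<in> ?R"
    then have "{g \<in> ?E. disjnt (path_ends e) (path_ends g)} = path_edges m r s i (2 * k - 2)"
      using assms by (auto simp: path_edges_def)
    then show "?Z e = path_matchings m r s i (2 * k - 2)"
      by (simp add: path_matchings_def)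
  qed
  also have "\<dots> = r * path_matchings m r s i (2 * k - 2)"
    by (simp add: card_image inj_on_def)
  finally show ?thesis
    by (simp add: path_matchings_def)
qed

text \<open>The same stripping of the last vertex, which is now joined to its predecessor by
  \<open>s\<close> edges.\<close>

lemma path_matchings_odd:
  assumes "1 \<le> i" "i \<le> 2 * k"
  shows "path_matchings m r s i (2 * k + 1)
    = (m + 1) * path_matchings m r s i (2 * k) + s * path_matchings m r s i (2 * k - 1)"
proof -
  let ?E = "path_edges m r s i (2 * k + 1)"
  let ?L = "Leaf_edge (2 * k + 1) ` {..<m}" and ?S = "S_edge k ` {..<s}"
  let ?Z = "\<lambda>e. num_matchings path_ends {g \<in> ?E. disjnt (path_ends e) (path_ends g)}"
  have "path_matchings m r s i (2 * k + 1)
      = num_matchings path_ends (?E - (?L \<union> ?S)) + sum ?Z (?L \<union> ?S)"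
    unfolding path_matchings_def
    by (rule num_matchings_split) (rule finite_path_edges, use assms in \<open>auto simp: path_edges_def\<close>)
  also have "?E - (?L \<union> ?S) = path_edges m r s i (2 * k)"
    using assms by (auto simp: path_edges_def)
  also have "sum ?Z (?L \<union> ?S) = sum ?Z ?L + sum ?Z ?S"
    by (rule sum.union_disjoint) auto
  also have "sum ?Z ?L = (\<Sum>e\<in>?L. path_matchings m r s i (2 * k))"
  proof (rule sum.cong[OF refl])
    fix e assume "e \<in> ?L"
    then have "{g \<in> ?E. disjnt (path_ends e) (path_ends g)} = path_edges m r s i (2 * k)"
      using assms by (auto simp: path_edges_def)
    then show "?Z e = path_matchings m r s i (2 * k)"
      by (simp add: path_matchings_def)
  qed
  also have "\<dots> = m * path_matchings m r s i (2 * k)"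
    by (simp add: card_image inj_on_def)
  also have "sum ?Z ?S = (\<Sum>e\<in>?S. path_matchings m r s i (2 * k - 1))"
  proof (rule sum.cong[OF refl])
    fix e assume "e \<in> ?S"
    then have "{g \<in> ?E. disjnt (path_ends e) (path_ends g)} = path_edges m r s i (2 * k - 1)"
      using assms by (auto simp: path_edges_def)
    then show "?Z e = path_matchings m r s i (2 * k - 1)"
      by (simp add: path_matchings_def)
  qed
  also have "\<dots> = s * path_matchings m r s i (2 * k - 1)"
    by (simp add: card_image inj_on_def)
  finally show ?thesis
    by (simp add: path_matchings_def)
qed

section \<open>From the cycle to paths\<close>

lemma mod_eq_iff_of_range:
  fixes a b N :: nat
  assumes "1 \<le> a" "a \<le> N" "1 \<le> b" "b \<le> N"
  shows "a mod N = b mod N \<longleftrightarrow> a = b"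
  using assms by (cases "a = N"; cases "b = N") auto

text \<open>Reduction modulo \<open>2 * n\<close> is injective on the indices from 1 to
  \<open>2 * n\<close>, so inside that range it changes no incidences between edges.\<close>

lemma num_matchings_U_ends_path_edges:
  assumes "1 \<le> i" "j \<le> 2 * n"
  shows "num_matchings (U_ends n) (path_edges m r s i j) = path_matchings m r s i j"
proof -
  \<comment> \<open>\<open>h\<close> reduces the indices, so that \<open>U_ends n\<close> is the
    image of \<open>path_ends\<close> under \<open>h\<close>; \<open>V\<close> is the range on which
    \<open>h\<close> is injective.\<close>
  define V where "V = {v. case v of Cyc t \<Rightarrow> 1 \<le> t \<and> t \<le> 2 * n | Leaf t l \<Rightarrow> 1 \<le> t \<and> t \<le> 2 * n}"
  define h where "h v = (case v of Cyc t \<Rightarrow> Cyc (t mod (2 * n)) | Leaf t l \<Rightarrow> Leaf (t mod (2 * n)) l)"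
    for v
  have inj: "inj_on h V"
    by (rule inj_onI) (auto simp: V_def h_def mod_eq_iff_of_range split: U_vertex.splits)
  have h: "U_ends n e = h ` path_ends e" for e
    by (cases e) (simp_all add: h_def)
  have V: "path_ends e \<subseteq> V" if "e \<in> path_edges m r s i j" for e
    using that assms by (auto simp: path_edges_def V_def) linarith+
  show ?thesis
    unfolding path_matchings_def
  proof (rule num_matchings_cong)
    fix e g assume "e \<in> path_edges m r s i j" "g \<in> path_edges m r s i j"
    then have "h ` path_ends e \<inter> h ` path_ends g = h ` (path_ends e \<inter> path_ends g)"
      using inj_on_image_Int[OF inj] V by metis
    then show "disjnt (U_ends n e) (U_ends n g) \<longleftrightarrow> disjnt (path_ends e) (path_ends g)"
      by (simp add: h disjnt_def)
  qed
qed

text \<open>The edges \<open>S_edge n\<close> close the cycle. Without them the path from 1 to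
  \<open>2 * n\<close> remains; using one of them removes both end vertices. For
  \<open>n = 1\<close> the inner path, from 2 to 1, is empty.\<close>

lemma hosoya_index_U_graph:
  assumes "n \<ge> 1"
  shows "hosoya_index (U_graph n m r s)
    = path_matchings m r s 1 (2 * n) + s * path_matchings m r s 2 (2 * n - 1)"
proof -
  let ?E = "edges (U_graph n m r s)"
  let ?S = "S_edge n ` {..<s}"
  let ?Z = "\<lambda>e. num_matchings (U_ends n) {g \<in> ?E. disjnt (U_ends n e) (U_ends n g)}"
  have Cyc_eq: "a mod (2 * n) = b mod (2 * n) \<longleftrightarrow> a = b"
    if "1 \<le> a" "a \<le> 2 * n" "1 \<le> b" "b \<le> 2 * n" for a b
    using that by (rule mod_eq_iff_of_range)
  have E: "?E = path_edges m r s 1 (2 * n) \<union> ?S"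
    using assms by (auto simp: U_graph_def path_edges_def)
  have "hosoya_index (U_graph n m r s) = num_matchings (U_ends n) ?E"
    by (simp add: hosoya_index_eq_num_matchings U_graph_def)
  also have "\<dots> = num_matchings (U_ends n) (?E - ?S) + sum ?Z ?S"
    by (rule num_matchings_split) (auto simp: E finite_path_edges)
  also have "?E - ?S = path_edges m r s 1 (2 * n)"
    by (auto simp: E path_edges_def)
  also have "num_matchings (U_ends n) \<dots> = path_matchings m r s 1 (2 * n)"
    by (rule num_matchings_U_ends_path_edges) simp_all
  also have "sum ?Z ?S = (\<Sum>e\<in>?S. path_matchings m r s 2 (2 * n - 1))"
  proof (rule sum.cong[OF refl])
    fix e assume "e \<in> ?S"
    \<comment> \<open>Both indices are written with representatives between 1 and
      \<open>2 * n\<close>, where \<open>Cyc_eq\<close> applies. Deleting \<open>mod_self\<close>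
      below keeps the simplifier from turning the first one into 0.\<close>
    then have e: "U_ends n e = {Cyc (2 * n mod (2 * n)), Cyc (1 mod (2 * n))}"
      by (auto simp: mod_Suc)
    have "{g \<in> ?E. disjnt (U_ends n e) (U_ends n g)} = path_edges m r s 2 (2 * n - 1)"
    proof (rule set_eqI)
      fix g
      show "g \<in> {g \<in> ?E. disjnt (U_ends n e) (U_ends n g)} \<longleftrightarrow> g \<in> path_edges m r s 2 (2 * n - 1)"
      proof (cases g)
        case (R_edge k l)
        then show ?thesis
          using assms unfolding e E
          by (cases "k = n") (auto simp: path_edges_def Cyc_eq simp del: mod_self One_nat_def)
      next
        case (S_edge k l)
        then show ?thesis
          using assms unfolding e E
          by (auto simp: path_edges_def Cyc_eq simp del: mod_self One_nat_def)
      next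
        case (Leaf_edge t l)
        then show ?thesis
          using assms unfolding e E
          by (cases "t = 1"; cases "t = 2 * n") (auto simp: path_edges_def Cyc_eq simp del: mod_self One_nat_def)
      qed
    qed
    then show "?Z e = path_matchings m r s 2 (2 * n - 1)"
      by (simp add: num_matchings_U_ends_path_edges)
  qed
  also have "\<dots> = s * path_matchings m r s 2 (2 * n - 1)"
    by (simp add: card_image inj_on_def)
  finally show ?thesis .
qed

lemma hosoya_index_U_graph_pos:
  assumes "n \<ge> 1"
  shows "hosoya_index (U_graph n m r s) > 0"
  using finite_multigraph.finite_edges[OF finite_multigraph_U_graph[OF assms]]
  by (simp add: hosoya_index_eq_num_matchings num_matchings_pos)

section \<open>Recurrence for the Hosoya index\<close>

text \<open>Three consecutive stripping steps, from which the values at \<open>2 * k + 3\<close> and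
  \<open>2 * k + 1\<close> are eliminated. The product term stands on the left to avoid subtraction
  of natural numbers.\<close>

lemma path_matchings_1_recurrence:
  "path_matchings m r s 1 (2 * (k + 2)) + r * s * path_matchings m r s 1 (2 * k)
    = ((m + 1)\<^sup>2 + r + s) * path_matchings m r s 1 (2 * (k + 1))"
proof -
  let ?P = "path_matchings m r s 1"
  have "?P (2 * k + 4) = (m + 1) * ?P (2 * k + 3) + r * ?P (2 * k + 2)"
    using path_matchings_even[of 1 "k + 2" m r s] by (simp add: eval_nat_numeral)
  moreover have "?P (2 * k + 3) = (m + 1) * ?P (2 * k + 2) + s * ?P (2 * k + 1)"
    using path_matchings_odd[of 1 "k + 1" m r s] by (simp add: eval_nat_numeral)
  moreover have "?P (2 * k + 2) = (m + 1) * ?P (2 * k + 1) + r * ?P (2 * k)"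
    using path_matchings_even[of 1 "k + 1" m r s] by (simp add: eval_nat_numeral)
  ultimately have "?P (2 * k + 4) + r * s * ?P (2 * k) = ((m + 1)\<^sup>2 + r + s) * ?P (2 * k + 2)"
    by algebra
  then show ?thesis
    by (simp add: algebra_simps eval_nat_numeral)
qed

text \<open>The same elimination with the roles of \<open>r\<close> and \<open>s\<close> exchanged,
  which leaves the coefficients unchanged.\<close>

lemma path_matchings_2_recurrence:
  "path_matchings m r s 2 (2 * (k + 2) + 1) + r * s * path_matchings m r s 2 (2 * k + 1)
    = ((m + 1)\<^sup>2 + r + s) * path_matchings m r s 2 (2 * (k + 1) + 1)"
proof -
  let ?P = "path_matchings m r s 2"
  have "?P (2 * k + 5) = (m + 1) * ?P (2 * k + 4) + s * ?P (2 * k + 3)"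
    using path_matchings_odd[of 2 "k + 2" m r s] by (simp add: eval_nat_numeral)
  moreover have "?P (2 * k + 4) = (m + 1) * ?P (2 * k + 3) + r * ?P (2 * k + 2)"
    using path_matchings_even[of 2 "k + 2" m r s] by (simp add: eval_nat_numeral)
  moreover have "?P (2 * k + 3) = (m + 1) * ?P (2 * k + 2) + s * ?P (2 * k + 1)"
    using path_matchings_odd[of 2 "k + 1" m r s] by (simp add: eval_nat_numeral)
  ultimately have "?P (2 * k + 5) + r * s * ?P (2 * k + 1) = ((m + 1)\<^sup>2 + r + s) * ?P (2 * k + 3)"
    by algebra
  then show ?thesis
    by (simp add: algebra_simps eval_nat_numeral)
qed

lemma path_matchings_1_2: "path_matchings m r s 1 2 = (m + 1)\<^sup>2 + r"
  using path_matchings_even[of 1 1 m r s]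
  by (simp add: path_matchings_empty path_matchings_singleton[of m r s "Suc 0", simplified]
      power2_eq_square)

lemma hosoya_index_U_graph_1: "hosoya_index (U_graph 1 m r s) = (m + 1)\<^sup>2 + r + s"
  using hosoya_index_U_graph[of 1 m r s] path_matchings_1_2[of m r s]
  by (simp add: path_matchings_empty)

text \<open>This is the recurrence at index 0 with the value 2 in place of the Hosoya index; it
  explains the convention for \<open>u 0\<close>. The edgeless \<open>U_graph 0 m r s\<close> would
  give 1.\<close>

lemma hosoya_index_U_graph_2:
  "hosoya_index (U_graph 2 m r s) + 2 * r * s = ((m + 1)\<^sup>2 + r + s)\<^sup>2"
proof -
  have "path_matchings m r s 2 3 = (m + 1)\<^sup>2 + s"
    using path_matchings_odd[of 2 1 m r s] path_matchings_singleton[of m r s 2]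
    by (simp add: path_matchings_empty power2_eq_square numeral_3_eq_3)
  moreover have "path_matchings m r s 1 4 + r * s = ((m + 1)\<^sup>2 + r + s) * ((m + 1)\<^sup>2 + r)"
    using path_matchings_1_recurrence[of m r s 0] path_matchings_1_2[of m r s]
    by (simp add: path_matchings_empty)
  moreover have "hosoya_index (U_graph 2 m r s)
      = path_matchings m r s 1 4 + s * path_matchings m r s 2 3"
    using hosoya_index_U_graph[of 2 m r s] by simp
  ultimately show ?thesis
    by algebra
qed

text \<open>Both path counts satisfy the same linear recurrence, hence so does their combination in
  \<open>hosoya_index_U_graph\<close>.\<close>

lemma hosoya_index_U_graph_recurrence:
  assumes "n \<ge> 1"
  shows "hosoya_index (U_graph (n + 2) m r s) + r * s * hosoya_index (U_graph n m r s)
    = ((m + 1)\<^sup>2 + r + s) * hosoya_index (U_graph (n + 1) m r s)"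
proof -
  let ?P = "path_matchings m r s 1" and ?Q = "path_matchings m r s 2"
  let ?M = "(m + 1)\<^sup>2 + r + s"
  obtain k where k: "n = k + 1"
    using assms by (metis add.commute le_Suc_ex)
  have h0: "hosoya_index (U_graph n m r s) = ?P (2 * n) + s * ?Q (2 * k + 1)"
    using hosoya_index_U_graph[of n m r s] by (simp add: k)
  have h1: "hosoya_index (U_graph (n + 1) m r s) = ?P (2 * (n + 1)) + s * ?Q (2 * (k + 1) + 1)"
    using hosoya_index_U_graph[of "n + 1" m r s] by (simp add: k)
  have h2: "hosoya_index (U_graph (n + 2) m r s) = ?P (2 * (n + 2)) + s * ?Q (2 * (k + 2) + 1)"
    using hosoya_index_U_graph[of "n + 2" m r s] by (simp add: k)
  have "hosoya_index (U_graph (n + 2) m r s) + r * s * hosoya_index (U_graph n m r s)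
      = (?P (2 * (n + 2)) + r * s * ?P (2 * n))
        + s * (?Q (2 * (k + 2) + 1) + r * s * ?Q (2 * k + 1))"
    unfolding h0 h2 by (simp only: distrib_left ac_simps)
  also have "\<dots> = ?M * ?P (2 * (n + 1)) + s * (?M * ?Q (2 * (k + 1) + 1))"
    by (simp only: path_matchings_1_recurrence path_matchings_2_recurrence)
  also have "\<dots> = ?M * hosoya_index (U_graph (n + 1) m r s)"
    unfolding h1 by (simp only: distrib_left mult.left_commute)
  finally show ?thesis .
qed

section \<open>Continued fraction and closed formula\<close>

text \<open>The recurrence has characteristic roots \<open>\<alpha>\<close> and
  \<open>\<beta>\<close>, so it holds for both sequences of powers; their sum has the right initial
  values.\<close>

lemma linear_recurrence_closed_form:
  fixes u :: "nat \<Rightarrow> 'a::comm_ring_1"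
  assumes "u 0 = 2" "u 1 = \<alpha> + \<beta>"
    and "\<And>n. u (n + 2) = (\<alpha> + \<beta>) * u (n + 1) - \<alpha> * \<beta> * u n"
  shows "u n = \<alpha> ^ n + \<beta> ^ n"
proof (induction n rule: induct_nat_012)
  case (ge2 n)
  then show ?case
    using assms(3)[of n] by (simp add: algebra_simps)
qed (use assms in simp_all)

theorem theorem1:
  fixes r s m :: nat and u x :: "nat \<Rightarrow> real" and M :: real
  assumes "r \<ge> 1" and "s \<ge> 1"
    and M: "M = (real m + 1)\<^sup>2 + real r + real s"
    and u_0: "u 0 = 2"
    and u: "\<And>k. k \<ge> 1 \<Longrightarrow> u k = real (hosoya_index (U_graph k m r s))"
    and x_1: "x 1 = M - M / 2"
    and x_Suc: "\<And>k. k \<ge> 1 \<Longrightarrow> x (k + 1) = M - real r * real s / x k"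
  shows "\<forall>n\<ge>1.
      u n / u (n - 1) = x n \<and>
      u n / u (n - 1) =
        foldr (\<lambda>b t. b - real r * real s / t) (replicate (n - 1) M) (M - M / 2) \<and>
      u n = ((M + sqrt (M\<^sup>2 - 4 * real r * real s)) / 2) ^ n
          + ((M - sqrt (M\<^sup>2 - 4 * real r * real s)) / 2) ^ n"
proof -
  have M': "M = real ((m + 1)\<^sup>2 + r + s)"
    by (simp add: M add.commute)
  have pos: "u n > 0" for n
    using u[of n] u_0 hosoya_index_U_graph_pos[of n m r s] by (cases "n = 0") simp_all
  have u_1: "u 1 = M"
    using hosoya_index_U_graph_1 by (simp add: u M')
  \<comment> \<open>For \<open>n = 0\<close> this rests on the convention \<open>u 0 = 2\<close> and
    the separate count for \<open>U_graph 2\<close>.\<close>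
  have rec: "u (n + 2) = M * u (n + 1) - real r * real s * u n" for n
  proof (cases "n = 0")
    case True
    have "u 2 + 2 * real r * real s = M\<^sup>2"
      using arg_cong[OF hosoya_index_U_graph_2[of m r s], of real] by (simp add: u M')
    then show ?thesis
      using True u_0 u_1 by (simp add: power2_eq_square numeral_2_eq_2)
  next
    case False
    then have "u (n + 2) + real r * real s * u n = M * u (n + 1)"
      using arg_cong[OF hosoya_index_U_graph_recurrence[of n m r s], of real]
      by (simp add: u M' del: add_2_eq_Suc')
    then show ?thesis
      by simp
  qed
  \<comment> \<open>The recurrence divided by \<open>u (n + 1)\<close>; positivity of
    \<open>u\<close> makes the quotients genuine.\<close>
  have ratio: "u (n + 2) / u (n + 1) = M - real r * real s / (u (n + 1) / u n)" for n
    using pos[of n] pos[of "n + 1"] rec[of n] by (simp add: field_simps)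
  have x: "u (n + 1) / u n = x (n + 1)" for n
  proof (induction n)
    case 0
    then show ?case using u_0 u_1 x_1 by simp
  next
    case (Suc n)
    then show ?case using ratio[of n] x_Suc[of "n + 1"] by simp
  qed
  have frac: "u (n + 1) / u n
      = foldr (\<lambda>b t. b - real r * real s / t) (replicate n M) (M - M / 2)" for n
  proof (induction n)
    case 0
    then show ?case using u_0 u_1 by simp
  next
    case (Suc n)
    then show ?case using ratio[of n] by simp
  qed
  define D where "D = M\<^sup>2 - 4 * real r * real s"
  \<comment> \<open>Since \<open>M\<close> is at least \<open>r + s\<close>, the discriminant is at
    least the square of \<open>r - s\<close>. Its nonnegativity is what makes \<open>sqrt D\<close>
    square to \<open>D\<close>.\<close>
  have "(real r + real s)\<^sup>2 \<le> M\<^sup>2"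
    by (intro power_mono) (simp_all add: M)
  moreover have "(real r + real s)\<^sup>2 - 4 * real r * real s = (real r - real s)\<^sup>2"
    by (simp add: power2_eq_square algebra_simps)
  ultimately have "D \<ge> 0"
    unfolding D_def by (smt (verit) zero_le_power2)
  then have "(sqrt D)\<^sup>2 = M\<^sup>2 - 4 * real r * real s"
    by (simp add: D_def)
  then have prod: "(M + sqrt D) / 2 * ((M - sqrt D) / 2) = real r * real s"
    by (simp add: power2_eq_square algebra_simps)
  have sum: "(M + sqrt D) / 2 + (M - sqrt D) / 2 = M"
    by (simp add: field_simps)
  \<comment> \<open>By \<open>sum\<close> and \<open>prod\<close>, the two bases are the roots of
    the characteristic polynomial of \<open>rec\<close>.\<close>
  have closed: "u n = ((M + sqrt D) / 2) ^ n + ((M - sqrt D) / 2) ^ n" for n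
    by (rule linear_recurrence_closed_form) (simp_all only: prod sum u_0 u_1 rec)
  show ?thesis
  proof (intro allI impI)
    fix n :: nat
    assume "n \<ge> 1"
    then obtain k where "n = k + 1"
      by (metis add.commute le_Suc_ex)
    then show "u n / u (n - 1) = x n \<and>
      u n / u (n - 1) =
        foldr (\<lambda>b t. b - real r * real s / t) (replicate (n - 1) M) (M - M / 2) \<and>
      u n = ((M + sqrt (M\<^sup>2 - 4 * real r * real s)) / 2) ^ n
          + ((M - sqrt (M\<^sup>2 - 4 * real r * real s)) / 2) ^ n"
      using x[of k] frac[of k] closed[of n] unfolding D_def by simp
  qed
qed

end
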